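(* Let $1<p<q<+\infty$, $\theta=p/q$, and let $s,s_1,\beta$ be real numbers with $s=\theta s_1-(1-\theta)\beta$ and $-\beta<s<s_1$. Then there is a constant $C>0$ such that for every function $f$ with $f\in\dot{W}^{s_1,p}(\mathbb{Z}_2)$ and $f\in\dot{B}^{-\beta,\infty}_{\infty}(\mathbb{Z}_2)$, $$\|f\|_{\dot{W}^{s,q}}\leq C\,\|f\|_{\dot{W}^{s_1,p}}^{\theta}\,\|f\|_{\dot{B}^{-\beta,\infty}_{\infty}}^{1-\theta}.$$
   Context: $\mathbb{Z}_2=\{x\in\mathbb{Q}_2:\ |x|_2\le 1\}$ is the group of $2$-adic integers, with Haar measure $dx$ normalized so that $\mathbb{Z}_2$ has measure $1$; $|E|$ denotes the measure of $E$. Lebesgue spaces are taken with respect to $dx$. Functions $f$ are real-valued and in $L^1(\mathbb{Z}_2)$. For $f\in L^1(\mathbb{Z}_2)$ and $j\in\mathbb{N}=\{0,1,2,\dots\}$, $S_j(f)$ is the conditional expectation of $f$ with respect to the algebra generated by the cosets of $2^j\mathbb{Z}_2$: $$S_j(f)(x)=\frac{1}{|x+2^j\mathbb{Z}_2|}\int_{x+2^j\mathbb{Z}_2}f(y)\,dy,$$ and the dyadic blocks are $\Delta_j(f)=S_{j+1}(f)-S_j(f)$. The homogeneous Sobolev and Besov (semi)norms are $$\|f\|_{\dot{W}^{s,p}}=\left\|\Big(\sum_{j\in\mathbb{N}}2^{2js}|\Delta_jf|^2\Big)^{1/2}\right\|_{L^p},\qquad \|f\|_{\dot{B}^{-\beta,\infty}_{\infty}}=\sup_{j\in\mathbb{N}}2^{-j\beta}\|\Delta_jf\|_{L^\infty},$$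 for $1<p<+\infty$ and real $s,\beta$; membership in the corresponding space means finiteness of the (semi)norm. *)

theory Defs
  imports "HOL-Probability.Probability"
begin

subsection \<open>The field of 2-adic numbers\<close>

text \<open>
  The 2-adic absolute value on the rationals: \<open>\<bar>n / d\<bar>\<^sub>2 = 2 ^ (v(d) - v(n))\<close>, where \<open>v\<close> is the
  exponent of 2. The 2-adic numbers are its Cauchy sequences modulo null sequences.
\<close>

definition abs2 :: "rat \<Rightarrow> real" where
  "abs2 r = (if r = 0 then 0 else
     2 powi (int (multiplicity 2 (snd (quotient_of r))) - int (multiplicity 2 (fst (quotient_of r)))))"

lemma two_prime_elem: "prime_elem (2 :: int)"
  using prime_elem_iff_prime_abs[of "2::int"] by simp

lemma abs2_frac:
  fixes a b :: int
  assumes "a \<noteq> 0" "b \<noteq> 0"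
  shows "abs2 (of_int a / of_int b) = 2 powi (int (multiplicity 2 b) - int (multiplicity 2 a))"
proof -
  define r :: rat where "r = of_int a / of_int b"
  obtain n d where nd: "quotient_of r = (n, d)" by force
  have d: "d > 0" and r: "r = of_int n / of_int d"
    using quotient_of_denom_pos[OF nd] quotient_of_div[OF nd] by auto
  have r0: "r \<noteq> 0" using assms by (simp add: r_def)
  hence n: "n \<noteq> 0" using r by auto
  have "(of_int (a * d) :: rat) = of_int (n * b)"
    using r assms d unfolding r_def by (simp add: field_simps)
  hence eq: "a * d = n * b" by (simp only: of_int_eq_iff)
  have "multiplicity 2 a + multiplicity 2 d = multiplicity 2 n + multiplicity 2 b"
    using prime_elem_multiplicity_mult_distrib[OF two_prime_elem, of a d]
      prime_elem_multiplicity_mult_distrib[OF two_prime_elem, of n b] eq assms d n by auto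
  hence "int (multiplicity 2 d) - int (multiplicity 2 n) = int (multiplicity 2 b) - int (multiplicity 2 a)"
    by linarith
  thus ?thesis using r0 nd unfolding abs2_def r_def[symmetric] by simp
qed

lemma rat_frac_cases:
  fixes r :: rat
  obtains a b :: int where "r = of_int a / of_int b" "b \<noteq> 0" "(a = 0) = (r = 0)"
proof -
  obtain n d where nd: "quotient_of r = (n, d)" by force
  show ?thesis
    by (rule that[of n d]) (use quotient_of_denom_pos[OF nd] quotient_of_div[OF nd] in auto)
qed

lemma abs2_nonneg [simp]: "0 \<le> abs2 r" and abs2_eq_0 [simp]: "abs2 r = 0 \<longleftrightarrow> r = 0"
  by (auto simp: abs2_def)

lemma abs2_0 [simp]: "abs2 0 = 0" by (simp add: abs2_def)
lemma abs2_pos: "r \<noteq> 0 \<Longrightarrow> 0 < abs2 r"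
  by (simp add: less_le)

lemma abs2_mult: "abs2 (x * y) = abs2 x * abs2 y"
proof (cases "x = 0 \<or> y = 0")
  case False
  obtain a b where ab: "x = of_int a / of_int b" "b \<noteq> 0" "a \<noteq> 0"
    using False by (metis rat_frac_cases)
  obtain c d where cd: "y = of_int c / of_int d" "d \<noteq> 0" "c \<noteq> 0"
    using False by (metis rat_frac_cases)
  have "x * y = of_int (a * c) / of_int (b * d)" using ab cd by simp
  thus ?thesis
    using ab cd abs2_frac[of "a*c" "b*d"] abs2_frac[of a b] abs2_frac[of c d]
    by (simp add: prime_elem_multiplicity_mult_distrib[OF two_prime_elem] power_int_add[symmetric])
       (simp add: algebra_simps)
qed auto

lemma abs2_1 [simp]: "abs2 1 = 1"
  using abs2_frac[of 1 1] by simp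

lemma abs2_minus [simp]: "abs2 (- x) = abs2 x"
proof -
  have "abs2 (- 1) * abs2 (- 1) = 1" by (simp flip: abs2_mult)
  hence "abs2 (- 1) = 1"
    using abs2_nonneg[of "- 1"] square_eq_1_iff[of "abs2 (- 1)"] by linarith
  thus ?thesis using abs2_mult[of "- 1" x] by simp
qed

lemma abs2_minus_commute: "abs2 (x - y) = abs2 (y - x)"
  by (metis abs2_minus minus_diff_eq)

lemma abs2_inverse: "abs2 (inverse x) = inverse (abs2 x)"
proof (cases "x = 0")
  case False
  hence "abs2 x * abs2 (inverse x) = 1" by (simp flip: abs2_mult)
  thus ?thesis by (metis inverse_unique)
qed auto

lemma abs2_int_le: "abs2 (of_int n) \<le> 1 / 2 ^ j \<longleftrightarrow> 2 ^ j dvd n"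
proof (cases "n = 0")
  case False
  have "abs2 (of_int n) = 1 / 2 ^ multiplicity 2 n"
    using abs2_frac[of n 1] False by (simp add: power_int_minus divide_inverse)
  also have "\<dots> \<le> 1 / 2 ^ j \<longleftrightarrow> j \<le> multiplicity 2 n"
    by (simp add: field_simps)
  also have "\<dots> \<longleftrightarrow> 2 ^ j dvd n"
    using False by (intro power_dvd_iff_le_multiplicity[symmetric]) auto
  finally show ?thesis .
qed auto

lemma abs2_add_le_max: "abs2 (x + y) \<le> max (abs2 x) (abs2 y)"
proof -
  have *: "abs2 (1 + z) \<le> 1" if "abs2 z \<le> 1" for z
  proof -
    obtain a b where ab: "quotient_of z = (a, b)" by force
    have b: "b > 0" and z: "z = of_int a / of_int b" and cop: "coprime a b"
      using quotient_of_denom_pos[OF ab] quotient_of_div[OF ab] quotient_of_coprime[OF ab] by auto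
    have m: "multiplicity 2 b = 0"
    proof (rule ccontr)
      assume "multiplicity 2 b \<noteq> 0"
      hence b2: "2 dvd b" by (metis not_dvd_imp_multiplicity_0)
      with cop have a2: "\<not> 2 dvd a" using coprime_common_divisor[of a b 2] by auto
      hence "z \<noteq> 0" using z b by auto
      hence "abs2 z = 2 powi int (multiplicity 2 b)"
        using a2 ab by (simp add: abs2_def not_dvd_imp_multiplicity_0)
      moreover have "(2::real) ^ multiplicity 2 b > 1" using \<open>multiplicity 2 b \<noteq> 0\<close> by simp
      ultimately show False using that by simp
    qed
    have e: "1 + z = of_int (b + a) / of_int b" using b z by (simp add: field_simps)
    show ?thesis
    proof (cases "b + a = 0")
      case False
      have "(2::real) powi (- int (multiplicity 2 (b + a))) \<le> 1"
        by (simp add: power_int_minus field_simps)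
      thus ?thesis unfolding e using abs2_frac[OF False, of b] b m by simp
    qed (use e in simp)
  qed
  have **: "abs2 (x + y) \<le> abs2 x" if "abs2 y \<le> abs2 x" for x y
  proof (cases "x = 0")
    case False
    have "x + y = x * (1 + y / x)" using False by (simp add: field_simps)
    hence "abs2 (x + y) = abs2 x * abs2 (1 + y / x)" by (metis abs2_mult)
    moreover have "abs2 (1 + y / x) \<le> 1"
    proof (rule *)
      have "abs2 (y / x) = abs2 y * inverse (abs2 x)"
        by (simp only: divide_inverse abs2_mult abs2_inverse)
      also have "\<dots> \<le> abs2 x * inverse (abs2 x)"
        using that abs2_nonneg[of x] by (intro mult_right_mono) (simp_all del: abs2_nonneg)
      also have "\<dots> = 1" using False by simp
      finally show "abs2 (y / x) \<le> 1" .
    qed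
    ultimately show ?thesis by (simp add: mult_left_le)
  qed (use that in simp)
  show ?thesis using **[of y x] **[of x y] by (auto simp: max_def add.commute)
qed

lemma abs2_triangle: "abs2 (x + y) \<le> abs2 x + abs2 y"
  using abs2_add_le_max[of x y] abs2_nonneg[of x] abs2_nonneg[of y] by linarith

lemma abs2_diff_triangle: "abs2 (x - z) \<le> abs2 (x - y) + abs2 (y - z)"
  using abs2_triangle[of "x - y" "y - z"] by simp

lemma abs2_rev_triangle: "\<bar>abs2 x - abs2 y\<bar> \<le> abs2 (x - y)"
  using abs2_triangle[of "x - y" y] abs2_triangle[of "y - x" x]
  by (simp add: abs2_minus_commute)

definition cauchy2 :: "(nat \<Rightarrow> rat) \<Rightarrow> bool" where
  "cauchy2 X \<longleftrightarrow> (\<forall>e>0. \<exists>N. \<forall>m\<ge>N. \<forall>n\<ge>N. abs2 (X m - X n) < e)"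

definition null2 :: "(nat \<Rightarrow> rat) \<Rightarrow> bool" where
  "null2 X \<longleftrightarrow> (\<lambda>n. abs2 (X n)) \<longlonglongrightarrow> 0"

lemma cauchy2_const [simp]: "cauchy2 (\<lambda>_. r)"
  by (simp add: cauchy2_def)

lemma null2_const [simp]: "null2 (\<lambda>_. r) \<longleftrightarrow> r = 0"
  by (simp add: null2_def LIMSEQ_const_iff)

lemma cauchy2_minus: "cauchy2 X \<Longrightarrow> cauchy2 (\<lambda>n. - X n)"
  unfolding cauchy2_def by (simp add: abs2_minus_commute)

lemma null2_minus [simp]: "null2 (\<lambda>n. - X n) = null2 X"
  unfolding null2_def by simp

lemma null2_add: "null2 X \<Longrightarrow> null2 Y \<Longrightarrow> null2 (\<lambda>n. X n + Y n)"
  unfolding null2_def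
  by (rule tendsto_sandwich[where f="\<lambda>_. 0" and h="\<lambda>n. abs2 (X n) + abs2 (Y n)"])
     (auto simp: abs2_triangle intro: tendsto_add_zero)

lemma cauchy2_add: "cauchy2 X \<Longrightarrow> cauchy2 Y \<Longrightarrow> cauchy2 (\<lambda>n. X n + Y n)"
  unfolding cauchy2_def
proof (intro allI impI)
  fix e :: real
  assume X: "\<forall>e>0. \<exists>N. \<forall>m\<ge>N. \<forall>n\<ge>N. abs2 (X m - X n) < e"
    and Y: "\<forall>e>0. \<exists>N. \<forall>m\<ge>N. \<forall>n\<ge>N. abs2 (Y m - Y n) < e" and e: "0 < e"
  obtain M where M: "\<forall>m\<ge>M. \<forall>n\<ge>M. abs2 (X m - X n) < e" using X e by blast
  obtain N where N: "\<forall>m\<ge>N. \<forall>n\<ge>N. abs2 (Y m - Y n) < e" using Y e by blast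
  have "abs2 (X m + Y m - (X n + Y n)) < e" if "m \<ge> max M N" "n \<ge> max M N" for m n
  proof -
    have "X m + Y m - (X n + Y n) = (X m - X n) + (Y m - Y n)" by simp
    moreover have "abs2 (X m - X n) < e" "abs2 (Y m - Y n) < e" using M N that by auto
    ultimately show ?thesis
      using abs2_add_le_max[of "X m - X n" "Y m - Y n"] by (simp only: max_def split: if_splits)
  qed
  thus "\<exists>N. \<forall>m\<ge>N. \<forall>n\<ge>N. abs2 (X m + Y m - (X n + Y n)) < e" by blast
qed

lemma cauchy2_convergent: "cauchy2 X \<Longrightarrow> convergent (\<lambda>n. abs2 (X n))"
  unfolding Cauchy_convergent_iff[symmetric] Cauchy_def cauchy2_def dist_real_def
  by (meson abs2_rev_triangle order_le_less_trans)

lemma cauchy2_bounded: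
  assumes "cauchy2 X" obtains B where "B > 0" "\<And>n. abs2 (X n) \<le> B"
proof -
  have "Bseq (\<lambda>n. abs2 (X n))" using cauchy2_convergent[OF assms] by (rule convergent_imp_Bseq)
  thus ?thesis using that unfolding Bseq_def by auto
qed

lemma null2_mult: assumes "cauchy2 X" "null2 Y" shows "null2 (\<lambda>n. X n * Y n)"
proof -
  obtain B where B: "B > 0" "\<And>n. abs2 (X n) \<le> B" using assms(1) by (rule cauchy2_bounded) blast
  show ?thesis unfolding null2_def abs2_mult
    by (rule Lim_null_comparison[where g="\<lambda>n. B * abs2 (Y n)"])
       (use assms(2) B in \<open>auto simp: null2_def abs_mult mult_right_mono intro!: tendsto_mult_right_zero\<close>)
qed

lemma cauchy2_mult: assumes X: "cauchy2 X" and Y: "cauchy2 Y" shows "cauchy2 (\<lambda>n. X n * Y n)"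
  unfolding cauchy2_def
proof (intro allI impI)
  fix e :: real assume e: "0 < e"
  obtain A where A: "A > 0" "\<And>n. abs2 (X n) \<le> A" using X by (rule cauchy2_bounded) blast
  obtain B where B: "B > 0" "\<And>n. abs2 (Y n) \<le> B" using Y by (rule cauchy2_bounded) blast
  obtain M where M: "\<forall>m\<ge>M. \<forall>n\<ge>M. abs2 (X m - X n) < e / B"
    using X e B unfolding cauchy2_def by (meson divide_pos_pos)
  obtain N where N: "\<forall>m\<ge>N. \<forall>n\<ge>N. abs2 (Y m - Y n) < e / A"
    using Y e A unfolding cauchy2_def by (meson divide_pos_pos)
  have "abs2 (X m * Y m - X n * Y n) < e" if "m \<ge> max M N" "n \<ge> max M N" for m n
  proof -
    have "abs2 (X m * (Y m - Y n)) \<le> A * abs2 (Y m - Y n)"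
      using A by (simp add: abs2_mult mult_right_mono)
    also have "\<dots> < e" using N that A by (simp add: field_simps)
    finally have 1: "abs2 (X m * (Y m - Y n)) < e" .
    have "abs2 (Y n * (X m - X n)) \<le> B * abs2 (X m - X n)"
      using B by (simp add: abs2_mult mult_right_mono)
    also have "\<dots> < e" using M that B by (simp add: field_simps)
    finally have 2: "abs2 (Y n * (X m - X n)) < e" .
    have "X m * Y m - X n * Y n = X m * (Y m - Y n) + Y n * (X m - X n)"
      by (simp add: algebra_simps)
    thus ?thesis using 1 2 abs2_add_le_max[of "X m * (Y m - Y n)" "Y n * (X m - X n)"] by simp
  qed
  thus "\<exists>N. \<forall>m\<ge>N. \<forall>n\<ge>N. abs2 (X m * Y m - X n * Y n) < e" by blast
qed

lemma cauchy2_not_null2: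
  assumes X: "cauchy2 X" and nz: "\<not> null2 X"
  obtains c N where "c > 0" "\<And>n. n \<ge> N \<Longrightarrow> abs2 (X n) > c"
proof -
  obtain L where L: "(\<lambda>n. abs2 (X n)) \<longlonglongrightarrow> L"
    using cauchy2_convergent[OF X] by (auto simp: convergent_def)
  have "L \<ge> 0" by (rule LIMSEQ_le_const[OF L]) auto
  with nz L have "L > 0" unfolding null2_def by (cases "L = 0") auto
  hence "eventually (\<lambda>n. abs2 (X n) > L / 2) sequentially"
    by (intro order_tendstoD(1)[OF L]) simp
  thus ?thesis using that[of "L/2"] \<open>L > 0\<close> unfolding eventually_sequentially by auto
qed

lemma cauchy2_inverse:
  assumes X: "cauchy2 X" and nz: "\<not> null2 X"
  shows "cauchy2 (\<lambda>n. inverse (X n))"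
  unfolding cauchy2_def
proof (intro allI impI)
  fix e :: real assume e: "0 < e"
  obtain c N where c: "c > 0" "\<And>n. n \<ge> N \<Longrightarrow> abs2 (X n) > c"
    using cauchy2_not_null2[OF X nz] by blast
  obtain M where M: "\<forall>m\<ge>M. \<forall>n\<ge>M. abs2 (X m - X n) < e * c * c"
    using X e c unfolding cauchy2_def by (meson mult_pos_pos)
  have "abs2 (inverse (X m) - inverse (X n)) < e" if mn: "m \<ge> max M N" "n \<ge> max M N" for m n
  proof -
    have a: "abs2 (X m) > c" "abs2 (X n) > c" using c mn by auto
    hence nz: "X m \<noteq> 0" "X n \<noteq> 0" using c by auto
    have "abs2 (inverse (X m) - inverse (X n)) * (abs2 (X m) * abs2 (X n)) = abs2 (X n - X m)"
    proof -
      have "(inverse (X m) - inverse (X n)) * (X m * X n) = X n - X m"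
        using right_inverse[OF nz(1)] right_inverse[OF nz(2)] by algebra
      thus ?thesis by (metis abs2_mult)
    qed
    hence "abs2 (inverse (X m) - inverse (X n)) = abs2 (X n - X m) / (abs2 (X m) * abs2 (X n))"
      using nz by (simp add: field_simps)
    also have "\<dots> \<le> abs2 (X n - X m) / (c * c)"
      using a c by (intro divide_left_mono mult_mono mult_pos_pos) auto
    also have "\<dots> < e" using M mn c by (simp add: field_simps)
    finally show ?thesis .
  qed
  thus "\<exists>N. \<forall>m\<ge>N. \<forall>n\<ge>N. abs2 (inverse (X m) - inverse (X n)) < e" by blast
qed

definition rel2 :: "(nat \<Rightarrow> rat) \<Rightarrow> (nat \<Rightarrow> rat) \<Rightarrow> bool" where
  "rel2 X Y \<longleftrightarrow> cauchy2 X \<and> cauchy2 Y \<and> null2 (\<lambda>n. X n - Y n)"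

lemma rel2_null_iff: "rel2 X Y \<Longrightarrow> null2 X \<longleftrightarrow> null2 Y"
  unfolding rel2_def
  using null2_add[of X "\<lambda>n. - (X n - Y n)"] null2_add[of Y "\<lambda>n. X n - Y n"] null2_minus[of "\<lambda>n. X n - Y n"]
  by auto

lemma rel2_inverse:
  assumes r: "rel2 X Y" and nz: "\<not> null2 X"
  shows "rel2 (\<lambda>n. inverse (X n)) (\<lambda>n. inverse (Y n))"
proof -
  have X: "cauchy2 X" and Y: "cauchy2 Y" and XY: "null2 (\<lambda>n. X n - Y n)"
    using r by (auto simp: rel2_def)
  have nzY: "\<not> null2 Y" using nz rel2_null_iff[OF r] by simp
  obtain c N where c: "c > 0" "\<And>n. n \<ge> N \<Longrightarrow> abs2 (X n) > c"
    using cauchy2_not_null2[OF X nz] by blast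
  obtain d M where d: "d > 0" "\<And>n. n \<ge> M \<Longrightarrow> abs2 (Y n) > d"
    using cauchy2_not_null2[OF Y nzY] by blast
  have "null2 (\<lambda>n. inverse (X n) * (inverse (Y n) * (- (X n - Y n))))"
    by (intro null2_mult cauchy2_inverse X Y nz nzY) (simp only: null2_minus XY)
  moreover have "eventually (\<lambda>n. inverse (X n) * (inverse (Y n) * (- (X n - Y n))) = inverse (X n) - inverse (Y n)) sequentially"
    unfolding eventually_sequentially
  proof (intro exI allI impI)
    fix n assume "max M N \<le> n"
    hence "abs2 (X n) > c" "abs2 (Y n) > d" using c d by auto
    hence "X n \<noteq> 0" "Y n \<noteq> 0" using c d by auto
    thus "inverse (X n) * (inverse (Y n) * (- (X n - Y n))) = inverse (X n) - inverse (Y n)"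
      by (simp add: field_simps)
  qed
  ultimately have "null2 (\<lambda>n. inverse (X n) - inverse (Y n))"
    unfolding null2_def
    by (elim Lim_transform_eventually) (auto elim!: eventually_mono)
  thus ?thesis using cauchy2_inverse X Y nz nzY by (auto simp: rel2_def)
qed

quotient_type Q2 = "nat \<Rightarrow> rat" / partial: rel2
  morphisms rep_Q2 abs_Q2
proof (rule part_equivpI)
  show "\<exists>X. rel2 X X" by (rule exI[of _ "\<lambda>_. 0"]) (simp add: rel2_def)
  show "symp rel2"
    unfolding rel2_def symp_def null2_def by (auto simp: abs2_minus_commute)
  show "transp rel2"
  proof (rule transpI)
    fix X Y Z assume "rel2 X Y" "rel2 Y Z"
    thus "rel2 X Z" unfolding rel2_def using null2_add[of "\<lambda>n. X n - Y n" "\<lambda>n. Y n - Z n"] by auto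
  qed
qed

instantiation Q2 :: field
begin

lift_definition zero_Q2 :: Q2 is "\<lambda>_. 0" by (simp add: rel2_def)
lift_definition one_Q2 :: Q2 is "\<lambda>_. 1" by (simp add: rel2_def)

lift_definition plus_Q2 :: "Q2 \<Rightarrow> Q2 \<Rightarrow> Q2" is "\<lambda>X Y n. X n + Y n"
  unfolding rel2_def add_diff_add by (simp only: cauchy2_add null2_add simp_thms)

lift_definition uminus_Q2 :: "Q2 \<Rightarrow> Q2" is "\<lambda>X n. - X n"
  unfolding rel2_def minus_diff_minus by (simp only: cauchy2_minus null2_minus simp_thms)

lift_definition times_Q2 :: "Q2 \<Rightarrow> Q2 \<Rightarrow> Q2" is "\<lambda>X Y n. X n * Y n"
proof -
  fix X X' Y Y' assume "rel2 X X'" "rel2 Y Y'"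
  moreover have "(\<lambda>n. X n * Y n - X' n * Y' n) = (\<lambda>n. X n * (Y n - Y' n) + Y' n * (X n - X' n))"
    by (simp add: algebra_simps)
  ultimately show "rel2 (\<lambda>n. X n * Y n) (\<lambda>n. X' n * Y' n)"
    unfolding rel2_def by (simp only: cauchy2_mult null2_mult null2_add simp_thms)
qed

lift_definition inverse_Q2 :: "Q2 \<Rightarrow> Q2"
  is "\<lambda>X. if null2 X then (\<lambda>_. 0) else (\<lambda>n. inverse (X n))"
proof -
  fix X Y assume "rel2 X Y"
  thus "rel2 (if null2 X then \<lambda>_. 0 else (\<lambda>n. inverse (X n)))
             (if null2 Y then \<lambda>_. 0 else (\<lambda>n. inverse (Y n)))"
    using rel2_null_iff[of X Y] rel2_inverse[of X Y] by (auto simp: rel2_def)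
qed

definition "x - y = x + - y" for x y :: Q2
definition "x div y = x * inverse y" for x y :: Q2

instance
proof
  fix a b c :: Q2
  show "a + b = b + a" by transfer (simp add: rel2_def cauchy2_add add.commute)
  show "(a + b) + c = a + (b + c)" by transfer (simp add: rel2_def cauchy2_add add.assoc)
  show "0 + a = a" by transfer (simp add: rel2_def)
  show "- a + a = 0" by transfer (simp add: rel2_def)
  show "a - b = a + - b" by (rule minus_Q2_def)
  show "(a * b) * c = a * (b * c)" by transfer (simp add: rel2_def cauchy2_mult mult.assoc)
  show "a * b = b * a" by transfer (simp add: rel2_def cauchy2_mult mult.commute)
  show "1 * a = a" by transfer (simp add: rel2_def)
  show "(a + b) * c = a * c + b * c"
    by transfer (simp add: rel2_def cauchy2_add cauchy2_mult distrib_right)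
  show "(0 :: Q2) \<noteq> 1" by transfer (simp add: rel2_def null2_minus[of "\<lambda>_. 1", simplified])
  show "inverse a * a = 1" if "a \<noteq> 0"
    using that
  proof transfer
    fix X assume X: "rel2 X X" and "\<not> rel2 X (\<lambda>_. 0)"
    hence c: "cauchy2 X" and nz: "\<not> null2 X" by (auto simp: rel2_def)
    obtain c N where "c > 0" "\<And>n. n \<ge> N \<Longrightarrow> abs2 (X n) > c"
      using cauchy2_not_null2[OF c nz] by blast
    hence "X n \<noteq> 0" if "n \<ge> N" for n using that by fastforce
    hence "eventually (\<lambda>n. inverse (X n) * X n - 1 = 0) sequentially"
      unfolding eventually_sequentially by (intro exI[of _ N]) auto
    hence "null2 (\<lambda>n. inverse (X n) * X n - 1)"
      unfolding null2_def by (intro tendsto_eventually) (auto elim: eventually_mono)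
    thus "rel2 (\<lambda>n. (if null2 X then \<lambda>_. 0 else (\<lambda>n. inverse (X n))) n * X n) (\<lambda>_. 1)"
      using nz c by (simp add: rel2_def cauchy2_mult cauchy2_inverse)
  qed
  show "a div b = a * inverse b" by (rule divide_Q2_def)
  show "inverse (0 :: Q2) = 0" by transfer (simp add: rel2_def)
qed

end

lift_definition norm2 :: "Q2 \<Rightarrow> real" is "\<lambda>X. lim (\<lambda>n. abs2 (X n))"
proof -
  fix X Y assume r: "rel2 X Y"
  have "(\<lambda>n. abs2 (X n) - abs2 (Y n)) \<longlonglongrightarrow> 0"
    by (rule Lim_null_comparison[where g="\<lambda>n. abs2 (X n - Y n)"])
       (use r abs2_rev_triangle in \<open>auto simp: rel2_def null2_def\<close>)
  moreover obtain L where "(\<lambda>n. abs2 (Y n)) \<longlonglongrightarrow> L"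
    using r cauchy2_convergent[of Y] by (auto simp: rel2_def convergent_def)
  ultimately have "(\<lambda>n. abs2 (X n) - abs2 (Y n) + abs2 (Y n)) \<longlonglongrightarrow> 0 + L" by (rule tendsto_add)
  hence "(\<lambda>n. abs2 (X n)) \<longlonglongrightarrow> L" by simp
  with \<open>(\<lambda>n. abs2 (Y n)) \<longlonglongrightarrow> L\<close> show "lim (\<lambda>n. abs2 (X n)) = lim (\<lambda>n. abs2 (Y n))"
    by (simp add: limI)
qed


lemma Q2_cases:
  obtains X where "cauchy2 X" "x = abs_Q2 X"
proof (induct x)
  case (1 X)
  thus ?case by (auto simp: rel2_def)
qed

lemma rel2_refl: "cauchy2 X \<Longrightarrow> rel2 X X"
  by (simp add: rel2_def)

lemma norm2_tendsto: "cauchy2 X \<Longrightarrow> (\<lambda>n. abs2 (X n)) \<longlonglongrightarrow> norm2 (abs_Q2 X)"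
  using cauchy2_convergent[of X] by (simp add: norm2.abs_eq rel2_refl convergent_LIMSEQ_iff)

lemma norm2_nonneg [simp]: "0 \<le> norm2 x"
proof (cases x rule: Q2_cases)
  case (1 X)
  show ?thesis unfolding 1(2) by (rule LIMSEQ_le_const[OF norm2_tendsto[OF 1(1)]]) auto
qed

lemma norm2_eq_0 [simp]: "norm2 x = 0 \<longleftrightarrow> x = 0"
proof (cases x rule: Q2_cases)
  case (1 X)
  have "x = 0 \<longleftrightarrow> rel2 X (\<lambda>_. 0)"
    unfolding 1(2) zero_Q2_def using Quotient_rel[OF Quotient_Q2, of X "\<lambda>_. 0"] 1(1) by (auto simp: rel2_def)
  also have "\<dots> \<longleftrightarrow> null2 X" using 1(1) by (simp add: rel2_def)
  also have "\<dots> \<longleftrightarrow> norm2 x = 0"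
    using norm2_tendsto[OF 1(1)] LIMSEQ_unique unfolding 1(2) null2_def by metis
  finally show ?thesis by simp
qed

lemma norm2_mult: "norm2 (x * y) = norm2 x * norm2 y"
proof (cases x rule: Q2_cases)
  case X: (1 X)
  show ?thesis
  proof (cases y rule: Q2_cases)
    case Y: (1 Y)
    have "(\<lambda>n. abs2 (X n * Y n)) \<longlonglongrightarrow> norm2 x * norm2 y"
      unfolding abs2_mult X(2) Y(2) by (intro tendsto_mult norm2_tendsto X Y)
    moreover have "(\<lambda>n. abs2 (X n * Y n)) \<longlonglongrightarrow> norm2 (x * y)"
      unfolding X(2) Y(2) times_Q2.abs_eq[OF rel2_refl[OF X(1)] rel2_refl[OF Y(1)]]
      by (intro norm2_tendsto cauchy2_mult X Y)
    ultimately show ?thesis by (rule LIMSEQ_unique[symmetric])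
  qed
qed

lemma norm2_add_le_max: "norm2 (x + y) \<le> max (norm2 x) (norm2 y)"
proof (cases x rule: Q2_cases)
  case X: (1 X)
  show ?thesis
  proof (cases y rule: Q2_cases)
    case Y: (1 Y)
    have "(\<lambda>n. max (abs2 (X n)) (abs2 (Y n))) \<longlonglongrightarrow> max (norm2 x) (norm2 y)"
      unfolding X(2) Y(2) by (intro tendsto_max norm2_tendsto X Y)
    moreover have "(\<lambda>n. abs2 (X n + Y n)) \<longlonglongrightarrow> norm2 (x + y)"
      unfolding X(2) Y(2) plus_Q2.abs_eq[OF rel2_refl[OF X(1)] rel2_refl[OF Y(1)]]
      by (intro norm2_tendsto cauchy2_add X Y)
    ultimately show ?thesis by (intro LIMSEQ_le) (auto intro: abs2_add_le_max)
  qed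
qed

lemma norm2_1 [simp]: "norm2 1 = 1"
  using norm2_mult[of 1 1] norm2_eq_0[of 1] by (simp del: norm2_eq_0) 

lemma norm2_0 [simp]: "norm2 0 = 0"
  by simp

lemma norm2_minus [simp]: "norm2 (- x) = norm2 x"
proof -
  have "norm2 (- 1) * norm2 (- 1) = 1" by (simp flip: norm2_mult)
  hence "norm2 (- 1) = 1"
    using norm2_nonneg[of "- 1"] square_eq_1_iff[of "norm2 (- 1)"] by linarith
  thus ?thesis using norm2_mult[of "- 1" x] by simp
qed

lemma norm2_minus_commute: "norm2 (x - y) = norm2 (y - x)"
  by (metis norm2_minus minus_diff_eq)

lemma norm2_diff_le_max: "norm2 (x - z) \<le> max (norm2 (x - y)) (norm2 (y - z))"
  using norm2_add_le_max[of "x - y" "y - z"] by simp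

lemma norm2_inverse: "norm2 (inverse x) = inverse (norm2 x)"
proof (cases "x = 0")
  case False
  hence "norm2 x * norm2 (inverse x) = 1" by (simp flip: norm2_mult)
  thus ?thesis by (metis inverse_unique)
qed auto

lift_definition rat_to_Q2 :: "rat \<Rightarrow> Q2" is "\<lambda>r _. r"
  by (simp add: rel2_def)

lemma norm2_rat [simp]: "norm2 (rat_to_Q2 r) = abs2 r"
  using LIMSEQ_unique[OF norm2_tendsto[OF cauchy2_const[of r]]]
  by (simp add: rat_to_Q2_def)

lemma rat_to_Q2_add: "rat_to_Q2 (r + s) = rat_to_Q2 r + rat_to_Q2 s"
  by transfer (simp add: rel2_def)

lemma rat_to_Q2_minus: "rat_to_Q2 (- r) = - rat_to_Q2 r"
  by transfer (simp add: rel2_def)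

lemma rat_to_Q2_diff: "rat_to_Q2 (r - s) = rat_to_Q2 r - rat_to_Q2 s"
  using rat_to_Q2_add[of r "- s"] by (simp add: rat_to_Q2_minus)

lemma rat_to_Q2_0: "rat_to_Q2 0 = 0" and rat_to_Q2_1: "rat_to_Q2 1 = 1"
  by (transfer; simp add: rel2_def)+

lemma rat_to_Q2_of_nat: "rat_to_Q2 (of_nat n) = of_nat n"
  by (induction n) (simp_all add: rat_to_Q2_0 rat_to_Q2_1 rat_to_Q2_add)

lemma norm2_of_nat_diff_le: "norm2 (of_nat m - of_nat n) \<le> 1 / 2 ^ j \<longleftrightarrow> m mod 2 ^ j = n mod 2 ^ j"
proof -
  have "norm2 (of_nat m - of_nat n) = abs2 (of_int (int m - int n))"
    by (simp flip: rat_to_Q2_of_nat rat_to_Q2_diff)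
  also have "\<dots> \<le> 1 / 2 ^ j \<longleftrightarrow> 2 ^ j dvd int m - int n" by (rule abs2_int_le)
  also have "\<dots> \<longleftrightarrow> int m mod int (2 ^ j) = int n mod int (2 ^ j)"
    by (simp add: mod_eq_dvd_iff)
  also have "\<dots> \<longleftrightarrow> m mod 2 ^ j = n mod 2 ^ j"
    unfolding zmod_int[symmetric] by simp
  finally show ?thesis .
qed

lemma rat_to_Q2_dense:
  assumes "e > 0" obtains r where "norm2 (x - rat_to_Q2 r) < e"
proof (cases x rule: Q2_cases)
  case (1 X)
  obtain N where N: "\<forall>m\<ge>N. \<forall>n\<ge>N. abs2 (X m - X n) < e / 2"
    using 1(1) assms unfolding cauchy2_def by (meson half_gt_zero)
  define Y where "Y = (\<lambda>n. X n + - X N)"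
  have Y: "cauchy2 Y" unfolding Y_def by (intro cauchy2_add cauchy2_const 1)
  have "x - rat_to_Q2 (X N) = x + rat_to_Q2 (- X N)" by (simp add: rat_to_Q2_minus)
  also have "\<dots> = abs_Q2 Y"
    unfolding 1(2) rat_to_Q2_def Y_def map_fun_def id_o comp_def id_def
    by (rule plus_Q2.abs_eq[OF rel2_refl[OF 1(1)] rel2_refl[OF cauchy2_const[of "- X N"]]])
  finally have "x - rat_to_Q2 (X N) = abs_Q2 Y" .
  moreover have "norm2 (abs_Q2 Y) \<le> e / 2"
    by (rule LIMSEQ_le_const2[OF norm2_tendsto[OF Y]], rule exI[of _ N])
       (use N in \<open>auto simp: Y_def less_imp_le\<close>)
  ultimately show ?thesis using that[of "X N"] assms by simp
qed

lemma of_nat_dense_unit_ball: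
  assumes "norm2 x \<le> 1" obtains k :: nat where "k < 2 ^ j" "norm2 (x - of_nat k) \<le> 1 / 2 ^ j"
proof -
  obtain r where r: "norm2 (x - rat_to_Q2 r) < 1 / 2 ^ j" using rat_to_Q2_dense[of "1 / 2 ^ j" x] by auto
  also have "\<dots> \<le> 1" by simp
  finally have "norm2 (rat_to_Q2 r) \<le> 1"
    using norm2_diff_le_max[of "rat_to_Q2 r" 0 x] assms by (simp add: norm2_minus_commute)
  hence r1: "abs2 r \<le> 1" by simp
  obtain a b where ab: "quotient_of r = (a, b)" by force
  have b: "b > 0" and z: "r = of_int a / of_int b" and cop: "coprime a b"
    using quotient_of_denom_pos[OF ab] quotient_of_div[OF ab] quotient_of_coprime[OF ab] by auto
  have odd: "odd b"
  proof
    assume b2: "2 dvd b"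
    with cop have a2: "\<not> 2 dvd a" using coprime_common_divisor[of a b 2] by auto
    hence "r \<noteq> 0" using z b by auto
    hence "abs2 r = 2 powi int (multiplicity 2 b)"
      using a2 ab by (simp add: abs2_def not_dvd_imp_multiplicity_0)
    moreover have "multiplicity 2 b \<noteq> 0"
      using b b2 by (simp add: multiplicity_eq_zero_iff)
    hence "(2::real) ^ multiplicity 2 b > 1" by simp
    ultimately show False using r1 by simp
  qed
  hence "coprime b (2 ^ j)" by simp
  then obtain c d where cd: "c * b + d * 2 ^ j = 1"
    by (metis bezout_int coprime_imp_gcd_eq_1)
  define k where "k = nat ((a * c) mod 2 ^ j)"
  have k: "int k = (a * c) mod 2 ^ j" by (simp add: k_def)
  have k': "k < 2 ^ j"
  proof -
    have "int k < int (2 ^ j)" using k by simp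
    thus ?thesis by (simp only: of_nat_less_iff)
  qed
  obtain q where q: "a * c - int k = 2 ^ j * q"
    using k by (metis minus_mod_eq_mult_div)
  have "a - int k * b = a * (c * b + d * 2 ^ j) - int k * b" by (simp add: cd)
  also have "\<dots> = (a * c - int k) * b + a * d * 2 ^ j" by (simp add: algebra_simps)
  also have "\<dots> = 2 ^ j * (q * b + a * d)" by (simp add: q algebra_simps)
  finally have dvd: "2 ^ j dvd a - int k * b" by simp
  have "r - of_nat k = of_int (a - int k * b) / of_int b"
    using b z by (simp add: field_simps)
  hence "abs2 (r - of_nat k) = abs2 (of_int (a - int k * b)) * inverse (abs2 (of_int b))"
    by (simp only: divide_inverse abs2_mult abs2_inverse)
  also have "abs2 (of_int b) = 1"
    using abs2_frac[of b 1] b odd by (simp add: not_dvd_imp_multiplicity_0)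
  finally have "abs2 (r - of_nat k) \<le> 1 / 2 ^ j"
    using dvd by (simp only: abs2_int_le inverse_1 mult_1_right)
  hence "norm2 (rat_to_Q2 r - of_nat k) \<le> 1 / 2 ^ j"
    by (simp flip: rat_to_Q2_of_nat rat_to_Q2_diff)
  hence "norm2 (x - of_nat k) \<le> 1 / 2 ^ j"
    using norm2_diff_le_max[of x "of_nat k" "rat_to_Q2 r"] r by simp
  thus ?thesis using that k' by blast
qed

instantiation Q2 :: metric_space
begin

definition dist_Q2 :: "Q2 \<Rightarrow> Q2 \<Rightarrow> real" where "dist_Q2 x y = norm2 (x - y)"

definition uniformity_Q2 :: "(Q2 \<times> Q2) filter"
  where "uniformity_Q2 = (INF e\<in>{0<..}. principal {(x, y). dist x y < e})"

definition open_Q2 :: "Q2 set \<Rightarrow> bool"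
  where "open_Q2 U = (\<forall>x\<in>U. \<forall>\<^sub>F (x', y) in uniformity. x' = x \<longrightarrow> y \<in> U)"

instance
proof
  fix x y z :: Q2
  show "dist x y = 0 \<longleftrightarrow> x = y" by (simp add: dist_Q2_def)
  show "dist x y \<le> dist x z + dist y z"
    using norm2_diff_le_max[of x y z] norm2_nonneg[of "x - z"] norm2_nonneg[of "y - z"]
    unfolding dist_Q2_def norm2_minus_commute[of y z] by linarith
qed (simp_all add: uniformity_Q2_def open_Q2_def)

end

subsection \<open>The 2-adic integers and their Haar measure\<close>

typedef Z2 = "{x :: Q2. norm2 x \<le> 1}"
  by (rule exI[of _ 0]) simp

setup_lifting type_definition_Z2

instantiation Z2 :: comm_ring_1
begin

lift_definition zero_Z2 :: Z2 is 0 by simp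
lift_definition one_Z2 :: Z2 is 1 by simp
lift_definition plus_Z2 :: "Z2 \<Rightarrow> Z2 \<Rightarrow> Z2" is "(+)"
  using norm2_add_le_max order_trans by fastforce
lift_definition uminus_Z2 :: "Z2 \<Rightarrow> Z2" is uminus by simp
lift_definition minus_Z2 :: "Z2 \<Rightarrow> Z2 \<Rightarrow> Z2" is "(-)"
  using norm2_diff_le_max[of _ _ 0] order_trans by fastforce
lift_definition times_Z2 :: "Z2 \<Rightarrow> Z2 \<Rightarrow> Z2" is "(*)"
  by (simp add: norm2_mult mult_le_one)

instance
  by (standard; transfer) (simp_all add: algebra_simps)

end

instantiation Z2 :: metric_space
begin

definition dist_Z2 :: "Z2 \<Rightarrow> Z2 \<Rightarrow> real" where "dist_Z2 x y = dist (Rep_Z2 x) (Rep_Z2 y)"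

definition uniformity_Z2 :: "(Z2 \<times> Z2) filter"
  where "uniformity_Z2 = (INF e\<in>{0<..}. principal {(x, y). dist x y < e})"

definition open_Z2 :: "Z2 set \<Rightarrow> bool"
  where "open_Z2 U = (\<forall>x\<in>U. \<forall>\<^sub>F (x', y) in uniformity. x' = x \<longrightarrow> y \<in> U)"

instance
proof
  fix x y z :: Z2
  show "dist x y = 0 \<longleftrightarrow> x = y" by (simp add: dist_Z2_def Rep_Z2_inject)
  show "dist x y \<le> dist x z + dist y z"
    unfolding dist_Z2_def by (rule dist_triangle2)
qed (simp_all add: uniformity_Z2_def open_Z2_def)

end

definition dyadic_coset :: "nat \<Rightarrow> Z2 \<Rightarrow> Z2 set" where
  "dyadic_coset j x = {x + 2 ^ j * z | z. True}"

lemma dist_Z2_norm2: "dist x y = norm2 (Rep_Z2 (x - y))"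
  by (simp add: dist_Z2_def dist_Q2_def minus_Z2.rep_eq)

lemma dist_Z2_le_max: "dist x z \<le> max (dist x y) (dist y z)" for x y z :: Z2
  unfolding dist_Z2_def dist_Q2_def by (rule norm2_diff_le_max)

lemma Rep_Z2_of_nat: "Rep_Z2 (of_nat n) = of_nat n"
  by (induction n) (simp_all add: zero_Z2.rep_eq one_Z2.rep_eq plus_Z2.rep_eq)

lemma Rep_Z2_power: "Rep_Z2 (x ^ n) = Rep_Z2 x ^ n"
  by (induction n) (simp_all add: one_Z2.rep_eq times_Z2.rep_eq)

lemma Rep_Z2_two_power: "Rep_Z2 (2 ^ j) = 2 ^ j"
  using Rep_Z2_of_nat[of "2 ^ j"] by simp

lemma norm2_two_power: "norm2 (2 ^ j) = 1 / 2 ^ j"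
proof -
  have "norm2 2 = abs2 (of_int 2)"
    using norm2_rat[of "of_nat 2"] unfolding rat_to_Q2_of_nat by simp
  also have "\<dots> = 1 / 2"
    using abs2_frac[of 2 1] by (simp add: power_int_minus)
  finally have "norm2 2 = 1 / 2" .
  thus ?thesis by (induction j) (simp_all only: power_Suc power_0 norm2_mult norm2_1 times_divide_times_eq div_by_1 mult_1)
qed

lemma mem_dyadic_coset: "y \<in> dyadic_coset j x \<longleftrightarrow> dist y x \<le> 1 / 2 ^ j"
proof
  assume "y \<in> dyadic_coset j x"
  then obtain z where "y = x + 2 ^ j * z" by (auto simp: dyadic_coset_def)
  hence "dist y x = norm2 (2 ^ j * Rep_Z2 z)"
    by (simp add: dist_Z2_norm2 times_Z2.rep_eq Rep_Z2_two_power)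
  also have "\<dots> \<le> 1 / 2 ^ j"
    using Rep_Z2[of z] by (simp add: norm2_mult norm2_two_power divide_right_mono)
  finally show "dist y x \<le> 1 / 2 ^ j" .
next
  assume d: "dist y x \<le> 1 / 2 ^ j"
  have nz: "(2 :: Q2) ^ j \<noteq> 0"
  proof
    assume "(2 :: Q2) ^ j = 0"
    hence "norm2 ((2 :: Q2) ^ j) = 0" by (simp only: norm2_0)
    thus False unfolding norm2_two_power by simp
  qed
  define w where "w = Rep_Z2 (y - x) * inverse (2 ^ j)"
  have "norm2 w = norm2 (Rep_Z2 (y - x)) * 2 ^ j"
    unfolding w_def norm2_mult norm2_inverse norm2_two_power by simp
  also have "\<dots> \<le> 1"
    using d by (simp add: dist_Z2_norm2 le_divide_eq)
  finally have w: "norm2 w \<le> 1" .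
  have "Rep_Z2 (2 ^ j * Abs_Z2 w) = 2 ^ j * w"
    using w by (simp add: times_Z2.rep_eq Abs_Z2_inverse Rep_Z2_two_power)
  also have "\<dots> = Rep_Z2 (y - x) * (2 ^ j * inverse (2 ^ j))"
    unfolding w_def by (rule mult.left_commute)
  also have "\<dots> = Rep_Z2 (y - x)"
    unfolding right_inverse[OF nz] by simp
  finally have "2 ^ j * Abs_Z2 w = y - x" by (simp only: Rep_Z2_inject)
  hence "y = x + 2 ^ j * Abs_Z2 w" by simp
  thus "y \<in> dyadic_coset j x" by (auto simp: dyadic_coset_def)
qed

lemma dyadic_coset_eq: "y \<in> dyadic_coset j x \<Longrightarrow> dyadic_coset j y = dyadic_coset j x"
proof -
  assume y: "y \<in> dyadic_coset j x"
  have "dist z y \<le> 1 / 2 ^ j \<longleftrightarrow> dist z x \<le> 1 / 2 ^ j" for z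
    using y dist_Z2_le_max[of z x y] dist_Z2_le_max[of z y x]
    unfolding mem_dyadic_coset dist_commute[of x y] by linarith
  thus ?thesis by (auto simp: mem_dyadic_coset)
qed

lemma dyadic_coset_mono: "i \<le> j \<Longrightarrow> dyadic_coset j x \<subseteq> dyadic_coset i x"
proof
  fix y assume "i \<le> j" "y \<in> dyadic_coset j x"
  hence "dist y x \<le> 1 / 2 ^ j" by (simp add: mem_dyadic_coset)
  also have "\<dots> \<le> 1 / 2 ^ i" using \<open>i \<le> j\<close> by (intro divide_left_mono power_increasing) auto
  finally show "y \<in> dyadic_coset i x" by (simp add: mem_dyadic_coset)
qed

lemma self_mem_dyadic_coset [simp]: "x \<in> dyadic_coset j x"
  by (simp add: mem_dyadic_coset)

lemma dyadic_coset_of_nat: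
  obtains k :: nat where "k < 2 ^ j" "x \<in> dyadic_coset j (of_nat k)"
proof -
  have "norm2 (Rep_Z2 x) \<le> 1" using Rep_Z2[of x] by simp
  then obtain k where "k < 2 ^ j" "norm2 (Rep_Z2 x - of_nat k) \<le> 1 / 2 ^ j"
    by (rule of_nat_dense_unit_ball)
  thus ?thesis
    by (intro that[of k]) (simp_all add: mem_dyadic_coset dist_Z2_def dist_Q2_def Rep_Z2_of_nat)
qed

lemma of_nat_mem_dyadic_coset:
  "of_nat m \<in> dyadic_coset j (of_nat n) \<longleftrightarrow> m mod 2 ^ j = n mod 2 ^ j"
  by (simp add: mem_dyadic_coset dist_Z2_def dist_Q2_def Rep_Z2_of_nat norm2_of_nat_diff_le)

lemma open_dyadic_coset: "open (dyadic_coset j x)"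
  unfolding open_dist
proof (intro ballI exI conjI allI impI)
  fix y z assume y: "y \<in> dyadic_coset j x" and z: "dist z y < 1 / 2 ^ j"
  show "z \<in> dyadic_coset j x"
    using y z dist_Z2_le_max[of z x y] by (simp add: mem_dyadic_coset)
qed simp

lemma plus_dyadic_coset: "(+) a ` dyadic_coset j x = dyadic_coset j (a + x)"
  unfolding dyadic_coset_def by (auto simp: image_iff add.assoc)

definition coset_gen :: "Z2 set set" where
  "coset_gen = insert {} {dyadic_coset j (of_nat k) | j k. k < 2 ^ j}"

lemma dyadic_coset_in_gen: "dyadic_coset j x \<in> coset_gen"
proof -
  obtain k :: nat where "k < 2 ^ j" "x \<in> dyadic_coset j (of_nat k)"
    by (rule dyadic_coset_of_nat)
  thus ?thesis using dyadic_coset_eq[of x j "of_nat k"] by (auto simp: coset_gen_def)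
qed

lemma countable_coset_gen: "countable coset_gen"
proof -
  have "coset_gen \<subseteq> insert {} (range (\<lambda>(j, k). dyadic_coset j (of_nat k)))"
    unfolding coset_gen_def by auto
  thus ?thesis by (rule countable_subset) auto
qed

lemma Int_stable_coset_gen: "Int_stable coset_gen"
proof (rule Int_stableI)
  have *: "dyadic_coset i x \<inter> dyadic_coset j y \<in> coset_gen" if "i \<le> j" for i j x y
  proof (cases "dyadic_coset i x \<inter> dyadic_coset j y = {}")
    case False
    then obtain z where z: "z \<in> dyadic_coset i x" "z \<in> dyadic_coset j y" by blast
    have "dyadic_coset i x \<inter> dyadic_coset j y = dyadic_coset j z"
      using dyadic_coset_eq[OF z(1)] dyadic_coset_eq[OF z(2)] dyadic_coset_mono[OF that, of z] by auto
    thus ?thesis by (simp add: dyadic_coset_in_gen)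
  qed (simp add: coset_gen_def)
  fix A B assume AB: "A \<in> coset_gen" "B \<in> coset_gen"
  show "A \<inter> B \<in> coset_gen"
  proof (cases "A = {} \<or> B = {}")
    case False
    then obtain i x j y where "A = dyadic_coset i x" "B = dyadic_coset j y"
      using AB unfolding coset_gen_def by blast
    thus ?thesis using *[of i j x y] *[of j i y x] by (cases "i \<le> j") (auto simp: Int_commute)
  qed (auto simp: coset_gen_def)
qed

lemma sets_borel_Z2: "sets borel = sigma_sets UNIV coset_gen"
proof
  have "U \<in> sigma_sets UNIV coset_gen" if "open U" for U
  proof -
    define V where "V = \<Union> {A \<in> coset_gen. A \<subseteq> U}"
    have "U = V"
    proof (intro equalityI subsetI)
      fix x assume "x \<in> U"
      with that obtain e where e: "e > 0" "ball x e \<subseteq> U" by (meson open_contains_ball)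
      obtain j where j: "(1/2) ^ j < e" using e(1) real_arch_pow_inv[of e "1/2"] by auto
      have "dyadic_coset j x \<subseteq> ball x e"
        using j by (auto simp: mem_dyadic_coset dist_commute power_one_over)
      with e(2) have "dyadic_coset j x \<subseteq> U" by (rule subset_trans[rotated])
      thus "x \<in> V" unfolding V_def
        by (intro UnionI[of "dyadic_coset j x"]) (simp_all add: dyadic_coset_in_gen)
    qed (auto simp: V_def)
    moreover have "V \<in> sigma_sets UNIV coset_gen"
      unfolding V_def
      by (rule sigma_sets_UNION) (auto intro: countable_subset[OF _ countable_coset_gen])
    ultimately show ?thesis by simp
  qed
  hence "Collect open \<subseteq> sigma_sets UNIV coset_gen" by blast
  from sigma_sets_mono[OF this] show "sets borel \<subseteq> sigma_sets UNIV coset_gen"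
    by (simp add: borel_def)
  have "coset_gen \<subseteq> sets borel"
    by (auto simp: coset_gen_def intro!: borel_open open_dyadic_coset)
  thus "sigma_sets UNIV coset_gen \<subseteq> sets borel"
    using sets.sigma_sets_subset[of coset_gen borel] by simp
qed

definition is_haar :: "Z2 measure \<Rightarrow> bool" where
  "is_haar M \<longleftrightarrow> sets M = sets borel \<and> emeasure M UNIV = 1 \<and>
     (\<forall>a. \<forall>E\<in>sets borel. emeasure M ((+) a ` E) = emeasure M E)"

lemma dyadic_coset_borel [measurable]: "dyadic_coset j x \<in> sets borel"
  by (intro borel_open open_dyadic_coset)

lemma haar_dyadic_coset:
  assumes "is_haar M" shows "emeasure M (dyadic_coset j x) = ennreal (1 / 2 ^ j)"
proof -
  have sets: "sets M = sets borel" and one: "emeasure M UNIV = 1"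
    and inv: "\<And>a E. E \<in> sets borel \<Longrightarrow> emeasure M ((+) a ` E) = emeasure M E"
    using assms by (auto simp: is_haar_def)
  define c where "c = emeasure M (dyadic_coset j 0)"
  have c: "emeasure M (dyadic_coset j y) = c" for y
    using inv[OF dyadic_coset_borel[of j 0], of y] by (simp add: plus_dyadic_coset c_def)
  have disj: "disjoint_family_on (\<lambda>k. dyadic_coset j (of_nat k)) {..<2 ^ j}"
    unfolding disjoint_family_on_def
  proof (intro ballI impI)
    fix k l :: nat assume kl: "k \<in> {..<2 ^ j}" "l \<in> {..<2 ^ j}" "k \<noteq> l"
    show "dyadic_coset j (of_nat k) \<inter> dyadic_coset j (of_nat l) = {}"
    proof (rule ccontr)
      assume "dyadic_coset j (of_nat k) \<inter> dyadic_coset j (of_nat l) \<noteq> {}"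
      then obtain z where "z \<in> dyadic_coset j (of_nat k)" "z \<in> dyadic_coset j (of_nat l)" by blast
      hence "dyadic_coset j (of_nat k) = dyadic_coset j (of_nat l)"
        using dyadic_coset_eq by metis
      hence "of_nat k \<in> dyadic_coset j (of_nat l)" using self_mem_dyadic_coset by metis
      thus False using kl by (simp add: of_nat_mem_dyadic_coset)
    qed
  qed
  have "(\<Union>k<2 ^ j. dyadic_coset j (of_nat k)) = UNIV"
  proof (intro equalityI subsetI UNIV_I)
    fix x
    obtain k :: nat where "k < 2 ^ j" "x \<in> dyadic_coset j (of_nat k)" by (rule dyadic_coset_of_nat)
    thus "x \<in> (\<Union>k<2 ^ j. dyadic_coset j (of_nat k))" by auto
  qed
  hence "1 = emeasure M (\<Union>k<2 ^ j. dyadic_coset j (of_nat k))" using one by simp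
  also have "\<dots> = (\<Sum>k<2 ^ j. emeasure M (dyadic_coset j (of_nat k)))"
    by (rule sum_emeasure[symmetric]) (use disj in \<open>auto simp: sets intro!: dyadic_coset_borel\<close>)
  also have "\<dots> = 2 ^ j * c" by (simp add: c)
  finally have eq: "2 ^ j * c = 1" by simp
  have "c = ennreal (1 / 2 ^ j) * (2 ^ j * c)"
  proof -
    have "ennreal (1 / 2 ^ j) * 2 ^ j = ennreal (1 / 2 ^ j * 2 ^ j)"
      by (subst ennreal_mult) (simp_all flip: ennreal_power)
    hence "ennreal (1 / 2 ^ j) * 2 ^ j = 1" by simp
    thus ?thesis by (simp flip: mult.assoc)
  qed
  thus ?thesis using eq c[of x] by simp
qed

lemma measure_eqI_dyadic_coset:
  fixes M N :: "Z2 measure"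
  assumes "sets M = sets borel" "sets N = sets borel" "emeasure M UNIV \<noteq> \<infinity>"
    and "\<And>j x. emeasure M (dyadic_coset j x) = emeasure N (dyadic_coset j x)"
  shows "M = N"
proof (rule measure_eqI_generator_eq[OF Int_stable_coset_gen])
  have U: "dyadic_coset 0 0 = UNIV"
    using Rep_Z2 by (auto simp: mem_dyadic_coset dist_Z2_norm2)
  show "range (\<lambda>_::nat. UNIV) \<subseteq> coset_gen" using dyadic_coset_in_gen[of 0 0] U by simp
  show "emeasure M X = emeasure N X" if "X \<in> coset_gen" for X
    using that assms(4) by (auto simp: coset_gen_def)
qed (use assms sets_borel_Z2 in auto)

lemma haar_unique: "is_haar M \<Longrightarrow> is_haar N \<Longrightarrow> M = N"
  by (rule measure_eqI_dyadic_coset) (auto simp: haar_dyadic_coset, auto simp: is_haar_def)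

definition digit_sum :: "(nat \<Rightarrow> bool) \<Rightarrow> nat \<Rightarrow> nat" where
  "digit_sum w n = (\<Sum>i<n. of_bool (w i) * 2 ^ i)"

lemma digit_sum_eq_horner: "digit_sum w n = horner_sum of_bool 2 (map w [0..<n])"
  by (simp add: digit_sum_def horner_sum_eq_sum atLeast0LessThan)

lemma digit_sum_eq_iff:
  assumes "k < 2 ^ n" shows "digit_sum w n = k \<longleftrightarrow> (\<forall>i\<in>{..<n}. w i \<in> {bit k i})"
proof -
  have "take_bit n k = k" using assms by (simp add: take_bit_nat_eq_self)
  hence k: "i < n" if "bit k i" for i using that by (metis bit_take_bit_iff)
  have "digit_sum w n = k \<longleftrightarrow> (\<forall>i. (i < n \<and> w i) \<longleftrightarrow> bit k i)"
  proof -
    have "bit (digit_sum w n) i \<longleftrightarrow> i < n \<and> w i" for i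
      unfolding digit_sum_eq_horner bit_horner_sum_bit_iff by auto
    thus ?thesis by (subst bit_eq_iff) simp
  qed
  also have "\<dots> \<longleftrightarrow> (\<forall>i<n. w i = bit k i)" using k by metis
  finally show ?thesis by auto
qed

lemma digit_sum_mod: "j \<le> n \<Longrightarrow> digit_sum w n mod 2 ^ j = digit_sum w j mod 2 ^ j"
proof (induction n rule: dec_induct)
  case (step n)
  have "(2::nat) ^ n mod 2 ^ j = 0" using step(1) by (simp add: le_imp_power_dvd)
  hence "(of_bool (w n) * 2 ^ n) mod 2 ^ j = (0::nat)" by simp
  hence "(digit_sum w n + of_bool (w n) * 2 ^ n) mod 2 ^ j = digit_sum w n mod 2 ^ j"
    by (metis add.right_neutral mod_add_right_eq)
  thus ?case using step by (simp add: digit_sum_def)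
qed simp

lemma digit_sum_lt: "digit_sum w n < 2 ^ n"
  unfolding digit_sum_def by (induction n) auto

lemma abs2_digit_sum: 
  assumes "j \<le> m" "j \<le> n" shows "abs2 (of_nat (digit_sum w m) - of_nat (digit_sum w n)) \<le> 1 / 2 ^ j"
  using norm2_of_nat_diff_le[of "digit_sum w m" "digit_sum w n" j]
    digit_sum_mod[OF assms(1), of w] digit_sum_mod[OF assms(2), of w]
  by (simp flip: rat_to_Q2_of_nat rat_to_Q2_diff)

lemma cauchy2_digit_sum: "cauchy2 (\<lambda>n. of_nat (digit_sum w n))"
  unfolding cauchy2_def
proof (intro allI impI)
  fix e :: real assume "e > 0"
  then obtain j where j: "(1/2) ^ j < e" using real_arch_pow_inv[of e "1/2"] by auto
  show "\<exists>N. \<forall>m\<ge>N. \<forall>n\<ge>N. abs2 (of_nat (digit_sum w m) - of_nat (digit_sum w n)) < e"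
  proof (rule exI[of _ j], intro allI impI)
    fix m n assume "j \<le> m" "j \<le> n"
    from abs2_digit_sum[OF this, of w] j
    show "abs2 (of_nat (digit_sum w m) - of_nat (digit_sum w n)) < e" by (simp add: power_one_over)
  qed
qed

definition of_digits :: "(nat \<Rightarrow> bool) \<Rightarrow> Z2" where
  "of_digits w = Abs_Z2 (abs_Q2 (\<lambda>n. of_nat (digit_sum w n)))"

lemma norm2_of_digits: "norm2 (abs_Q2 (\<lambda>n. of_nat (digit_sum w n)) - of_nat (digit_sum w j)) \<le> 1 / 2 ^ j"
proof -
  define Y :: "nat \<Rightarrow> rat" where "Y = (\<lambda>n. of_nat (digit_sum w n) + - of_nat (digit_sum w j))"
  have Y: "cauchy2 Y" unfolding Y_def by (intro cauchy2_add cauchy2_const cauchy2_digit_sum)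
  have "abs_Q2 (\<lambda>n. of_nat (digit_sum w n)) - of_nat (digit_sum w j)
      = abs_Q2 (\<lambda>n. of_nat (digit_sum w n)) + rat_to_Q2 (- of_nat (digit_sum w j))"
    by (simp add: rat_to_Q2_minus rat_to_Q2_of_nat)
  also have "\<dots> = abs_Q2 Y"
    unfolding rat_to_Q2_def Y_def map_fun_def id_o comp_def id_def
    by (rule plus_Q2.abs_eq[OF rel2_refl[OF cauchy2_digit_sum] rel2_refl[OF cauchy2_const]])
  finally show ?thesis
    using LIMSEQ_le_const2[OF norm2_tendsto[OF Y], of "1 / 2 ^ j"] abs2_digit_sum[of j _ j w]
    by (auto simp: Y_def)
qed

lemma Rep_of_digits: "Rep_Z2 (of_digits w) = abs_Q2 (\<lambda>n. of_nat (digit_sum w n))"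
  unfolding of_digits_def
  by (rule Abs_Z2_inverse) (use norm2_of_digits[of w 0] in \<open>simp add: digit_sum_def\<close>)

lemma of_digits_mem_iff:
  assumes "k < 2 ^ j"
  shows "of_digits w \<in> dyadic_coset j (of_nat k) \<longleftrightarrow> (\<forall>i\<in>{..<j}. w i \<in> {bit k i})"
proof -
  have "of_digits w \<in> dyadic_coset j (of_nat (digit_sum w j))"
    using norm2_of_digits[of w j]
    by (simp add: mem_dyadic_coset dist_Z2_def dist_Q2_def Rep_Z2_of_nat Rep_of_digits)
  from dyadic_coset_eq[OF this]
  have "of_digits w \<in> dyadic_coset j (of_nat k) \<longleftrightarrow> of_nat (digit_sum w j) \<in> dyadic_coset j (of_nat k)"
    using dyadic_coset_eq self_mem_dyadic_coset by metis
  also have "\<dots> \<longleftrightarrow> digit_sum w j = k"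
    using assms digit_sum_lt[of w j] by (simp add: of_nat_mem_dyadic_coset)
  finally show ?thesis using digit_sum_eq_iff[OF assms] by simp
qed

lemma haar_exists: "\<exists>M. is_haar M"
proof -
  define B where "B = (\<lambda>_::nat. measure_pmf (bernoulli_pmf (1/2)))"
  interpret product_prob_space B UNIV
    unfolding B_def by unfold_locales
  define P where "P = PiM UNIV B"
  have space_P: "space P = UNIV" by (simp add: P_def B_def space_PiM)
  have vim: "of_digits -` dyadic_coset j (of_nat k) = {w \<in> space P. \<forall>i\<in>{..<j}. w i \<in> {bit k i}}"
    if "k < 2 ^ j" for j k
    using of_digits_mem_iff[OF that] by (auto simp: space_P)
  have meas: "of_digits \<in> measurable P borel"
  proof (rule measurable_sigma_sets[OF sets_borel_Z2])
    fix A assume "A \<in> coset_gen"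
    then consider "A = {}" | j k where "k < 2 ^ j" "A = dyadic_coset j (of_nat k)"
      by (auto simp: coset_gen_def)
    thus "of_digits -` A \<inter> space P \<in> sets P"
    proof cases
      case 2
      have "{w \<in> space P. \<forall>i\<in>{..<j}. w i \<in> {bit k i}} \<in> sets P"
        unfolding P_def
        by (intro sets.sets_Collect_finite_All sets_Collect_single') (auto simp: B_def)
      thus ?thesis using vim[OF 2(1)] by (simp add: 2(2) space_P)
    qed simp
  qed auto
  define M where "M = distr P borel of_digits"
  have coset_nat: "emeasure M (dyadic_coset j (of_nat k)) = ennreal (1 / 2 ^ j)" if "k < 2 ^ j" for j k
  proof -
    have "emeasure M (dyadic_coset j (of_nat k))
        = emeasure P {w \<in> space P. \<forall>i\<in>{..<j}. w i \<in> {bit k i}}"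
      unfolding M_def using vim[OF that]
      by (subst emeasure_distr[OF meas dyadic_coset_borel]) (simp add: space_P)
    also have "\<dots> = (\<Prod>i<j. emeasure (B i) {bit k i})"
      unfolding P_def by (rule emeasure_PiM_Collect) (auto simp: B_def)
    also have "\<dots> = (\<Prod>i<j. ennreal (1 / 2))"
    proof (rule prod.cong[OF refl])
      fix i
      show "emeasure (B i) {bit k i} = ennreal (1 / 2)"
        unfolding B_def emeasure_pmf_single by (cases "bit k i") simp_all
    qed
    also have "\<dots> = ennreal (1 / 2 ^ j)"
      by (subst prod_constant, subst ennreal_power) (simp_all add: power_one_over)
    finally show ?thesis .
  qed
  have coset: "emeasure M (dyadic_coset j x) = ennreal (1 / 2 ^ j)" for j x
  proof -
    obtain k :: nat where k: "k < 2 ^ j" "x \<in> dyadic_coset j (of_nat k)" by (rule dyadic_coset_of_nat)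
    show ?thesis unfolding dyadic_coset_eq[OF k(2)] by (rule coset_nat[OF k(1)])
  qed
  have P: "prob_space P" unfolding P_def by (rule prob_space_PiM) (simp add: B_def measure_pmf.prob_space_axioms)
  have M: "prob_space M" unfolding M_def by (rule prob_space.prob_space_distr[OF P meas])
  have sets_M: "sets M = sets borel" and space_M: "space M = UNIV" by (simp_all add: M_def)
  have trans: "emeasure M ((+) a ` E) = emeasure M E" if "E \<in> sets borel" for a E
  proof -
    have img: "(+) a ` A = (\<lambda>x. - a + x) -` A" for a :: Z2 and A
    proof (intro equalityI subsetI)
      fix x assume "x \<in> (\<lambda>x. - a + x) -` A"
      hence "x = a + (- a + x)" "- a + x \<in> A" by auto
      thus "x \<in> (+) a ` A" by blast
    qed auto
    have vimg: "(\<lambda>x. - a + x) -` dyadic_coset j y = dyadic_coset j (a + y)" for j y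
      unfolding img[symmetric] by (rule plus_dyadic_coset)
    have cm: "(\<lambda>x. - a + x) \<in> measurable M borel"
    proof (rule measurable_sigma_sets[OF sets_borel_Z2])
      fix A assume "A \<in> coset_gen"
      hence "A = {} \<or> (\<exists>j x. A = dyadic_coset j x)" by (auto simp: coset_gen_def)
      thus "(\<lambda>x. - a + x) -` A \<inter> space M \<in> sets M"
        unfolding space_M sets_M Int_UNIV_right by (elim disjE exE; simp only: vimg) auto
    qed auto
    have "M = distr M borel (\<lambda>x. - a + x)"
    proof (rule measure_eqI_dyadic_coset)
      fix j x
      show "emeasure M (dyadic_coset j x) = emeasure (distr M borel (\<lambda>x. - a + x)) (dyadic_coset j x)"
        by (subst emeasure_distr[OF cm dyadic_coset_borel])
           (simp only: space_M Int_UNIV_right vimg coset)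
    qed (use prob_space.emeasure_space_1[OF M] in \<open>simp_all add: sets_M space_M\<close>)
    hence "emeasure M E = emeasure (distr M borel (\<lambda>x. - a + x)) E" by simp
    also have "\<dots> = emeasure M ((+) a ` E)"
      by (subst emeasure_distr[OF cm that]) (simp only: space_M Int_UNIV_right img)
    finally show ?thesis by simp
  qed
  have "is_haar M"
    unfolding is_haar_def using sets_M trans prob_space.emeasure_space_1[OF M] by (simp add: space_M)
  thus ?thesis ..
qed

text \<open>
  The description is proper, by \<open>haar_exists\<close> and \<open>haar_unique\<close>.
\<close>

definition haar :: "Z2 measure" where
  "haar = (THE M. is_haar M)"

lemma is_haar_haar: "is_haar haar"
  unfolding haar_def using haar_exists haar_unique by (metis theI')

lemma sets_haar [simp, measurable_cong]: "sets haar = sets borel"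
  using is_haar_haar by (simp add: is_haar_def)

lemma space_haar [simp]: "space haar = UNIV"
  using sets_eq_imp_space_eq[OF sets_haar] by simp

lemma prob_space_haar: "prob_space haar"
  using is_haar_haar by (intro prob_spaceI) (simp add: is_haar_def)

lemma emeasure_haar_dyadic_coset: "emeasure haar (dyadic_coset j x) = ennreal (1 / 2 ^ j)"
  by (rule haar_dyadic_coset[OF is_haar_haar])


subsection \<open>Sobolev and Besov norms\<close>

definition dyadic_avg :: "nat \<Rightarrow> (Z2 \<Rightarrow> real) \<Rightarrow> Z2 \<Rightarrow> real" where
  "dyadic_avg j f x =
     1 / measure haar (dyadic_coset j x) * (LINT y:dyadic_coset j x|haar. f y)"

definition dyadic_block :: "nat \<Rightarrow> (Z2 \<Rightarrow> real) \<Rightarrow> Z2 \<Rightarrow> real" where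
  "dyadic_block j f x = dyadic_avg (j + 1) f x - dyadic_avg j f x"

text \<open>
  Norms take values in \<^typ>\<open>ennreal\<close>, so that they are defined for every integrable function and
  membership in the spaces is finiteness. The power below is meant for exponents \<open>r > 0\<close> only.
\<close>

definition ennpowr :: "ennreal \<Rightarrow> real \<Rightarrow> ennreal" where
  "ennpowr a r = (if a = \<infinity> then \<infinity> else ennreal (enn2real a powr r))"

definition Lp_norm :: "real \<Rightarrow> (Z2 \<Rightarrow> ennreal) \<Rightarrow> ennreal" where
  "Lp_norm p g = ennpowr (\<integral>\<^sup>+ x. ennpowr (g x) p \<partial>haar) (1 / p)"

definition Linf_norm :: "(Z2 \<Rightarrow> real) \<Rightarrow> ennreal" where
  "Linf_norm g = esssup haar (\<lambda>x. ennreal \<bar>g x\<bar>)"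

definition sobolev_norm :: "real \<Rightarrow> real \<Rightarrow> (Z2 \<Rightarrow> real) \<Rightarrow> ennreal" where
  "sobolev_norm s p f =
     Lp_norm p (\<lambda>x. ennpowr (\<Sum>j. ennreal (2 powr (2 * real j * s) * \<bar>dyadic_block j f x\<bar>\<^sup>2)) (1 / 2))"

text \<open>The norm of the Besov space of regularity \<open>-\<beta>\<close>; note the sign.\<close>

definition besov_norm :: "real \<Rightarrow> (Z2 \<Rightarrow> real) \<Rightarrow> ennreal" where
  "besov_norm \<beta> f = (SUP j. ennreal (2 powr (- real j * \<beta>)) * Linf_norm (dyadic_block j f))"

definition sobolev_space :: "real \<Rightarrow> real \<Rightarrow> (Z2 \<Rightarrow> real) set" where
  "sobolev_space s p = {f. integrable haar f \<and> sobolev_norm s p f < \<infinity>}"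

definition besov_space :: "real \<Rightarrow> (Z2 \<Rightarrow> real) set" where
  "besov_space \<beta> = {f. integrable haar f \<and> besov_norm \<beta> f < \<infinity>}"

end

(*
  The inequality holds pointwise before integration. At almost every x, with
  x_j = 2^(2js) |Delta_j f(x)|^2, X = sum_j 2^(2 j s1) |Delta_j f(x)|^2, Y = B^2 for the Besov
  norm B, and r = 2^(2(s1 + beta)), one has both x_j <= X r^(-(1-theta)j) and x_j <= Y r^(theta j).
  Splitting the sum where r^j passes X / Y leaves two geometric sums, each of them at most a
  constant times X^theta Y^(1-theta). Since theta q = p, taking L^q norms gives the claim.
*)
theory Submission
  imports Defs
begin

lemma ennpowr_0 [simp]: "ennpowr 0 r = 0"
  by (simp add: ennpowr_def)

lemma ennpowr_top [simp]: "ennpowr top r = top"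
  by (simp add: ennpowr_def)

lemma ennpowr_ennreal: "0 \<le> a \<Longrightarrow> ennpowr (ennreal a) r = ennreal (a powr r)"
  by (simp add: ennpowr_def)

lemma ennpowr_eq_0_iff [simp]: "ennpowr a r = 0 \<longleftrightarrow> a = 0"
  by (cases a) (auto simp: ennpowr_def)

text \<open>Holds for all real exponents, because \<open>ennpowr\<close> fixes \<open>0\<close> and
  \<open>top\<close> whatever the exponent (\<open>0 powr r = 0\<close>).\<close>

lemma ennpowr_ennpowr: "ennpowr (ennpowr a r) t = ennpowr a (r * t)"
  by (cases a) (auto simp: ennpowr_ennreal powr_powr)

lemma ennpowr_mult: "ennpowr (a * b) r = ennpowr a r * ennpowr b r"
proof (cases "a = 0 \<or> b = 0")
  case False
  then show ?thesis
    by (cases a; cases b)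
      (auto simp: ennpowr_ennreal ennreal_mult_top ennreal_top_mult powr_mult
        simp flip: ennreal_mult)
qed auto

lemma ennpowr_mono: "0 \<le> r \<Longrightarrow> a \<le> b \<Longrightarrow> ennpowr a r \<le> ennpowr b r"
  by (cases a; cases b) (auto simp: ennpowr_ennreal top_unique intro!: ennreal_leI powr_mono2)

lemma ennpowr_1 [simp]: "ennpowr a 1 = a"
  by (cases a) (auto simp: ennpowr_ennreal)

lemma borel_measurable_ennpowr [measurable]:
  assumes [measurable]: "f \<in> borel_measurable M"
  shows "(\<lambda>x. ennpowr (f x) r) \<in> borel_measurable M"
  unfolding ennpowr_def by measurable

text \<open>The estimate at one fixed point, stated for a bare sequence. The weighted series on the
  right may be infinite. \<open>K\<close> depends on \<open>r\<close> and \<open>\<theta>\<close>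
  alone, which makes the final constant uniform in \<open>f\<close>; its first summand comes from a
  finite sum of growing powers, its second from a decaying geometric tail.\<close>

lemma suminf_le_interpolation:
  fixes x :: "nat \<Rightarrow> real" and r \<theta> Y :: real
  assumes r: "1 < r" and \<theta>: "0 < \<theta>" "\<theta> < 1"
    and x: "\<And>j. 0 \<le> x j" and Y: "0 \<le> Y"
    and le: "\<And>j. x j \<le> Y * r powr (\<theta> * real j)"
  defines "K \<equiv> r powr \<theta> / (r powr \<theta> - 1) + 1 / (1 - r powr (- (1 - \<theta>)))"
  shows "(\<Sum>j. ennreal (x j)) \<le> ennreal K *
    ennpowr (\<Sum>j. ennreal (r powr ((1 - \<theta>) * real j) * x j)) \<theta> * ennpowr (ennreal Y) (1 - \<theta>)"
    (is "_ \<le> _ * ennpowr ?X \<theta> * _")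
proof -
  \<comment> \<open>The ratios of the growing bound \<open>Y * u ^ j\<close> and of the decaying
    bound \<open>X * v ^ j\<close>. Since \<open>u / v = r\<close>, the two bounds agree where
    \<open>r ^ j = X / Y\<close>.\<close>
  define u v where "u = r powr \<theta>" and "v = r powr (- (1 - \<theta>))"
  have u: "1 < u" and v: "0 < v" "v < 1"
    using r \<theta> by (auto simp: u_def v_def powr_less_one)
  have uj: "r powr (\<theta> * real j) = u ^ j" and vj: "r powr ((1 - \<theta>) * real j) = 1 / v ^ j" for j
    using r by (simp_all add: u_def v_def powr_realpow[symmetric] powr_powr powr_minus_divide[symmetric] algebra_simps)
  have K: "K > 0"
    unfolding K_def u_def[symmetric] v_def[symmetric]
    using u v by (intro add_pos_pos divide_pos_pos) auto
  \<comment> \<open>The quotient \<open>X / Y\<close> must be a positive real. If \<open>Y\<close>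
    or the weighted series vanishes, then every \<open>x j\<close> is 0; if the series is infinite,
    so is the right-hand side, because \<open>K\<close> and \<open>Y\<close> are positive.\<close>
  consider "\<forall>j. x j = 0" | "Y > 0" "?X = top"
    | X where "Y > 0" "X > 0" "?X = ennreal X"
  proof (cases "\<forall>j. x j = 0")
    case False
    then obtain j where j: "x j > 0"
      using x by (metis less_le)
    then have Y0: "Y > 0"
      using le[of j] Y by (cases "Y = 0") auto
    have X0: "?X \<noteq> 0"
    proof
      assume "?X = 0"
      then have "ennreal (r powr ((1 - \<theta>) * real j) * x j) = 0"
        by (subst (asm) suminf_eq_zero_iff) auto
      with j r show False by (simp add: ennreal_eq_0_iff mult_le_0_iff)
    qed
    show ?thesis
      using that(2,3) Y0 X0 by (cases ?X) (auto simp: less_le)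
  qed
  then show ?thesis
  proof cases
    case 1
    then show ?thesis by simp
  next
    case 2
    then show ?thesis
      using K by (simp add: ennreal_mult_top ennreal_top_mult ennpowr_ennreal)
  next
    case (3 X)
    have leX: "x j \<le> X * v ^ j" for j
    proof -
      have "(\<Sum>i\<in>{j}. ennreal (r powr ((1 - \<theta>) * real i) * x i)) \<le> ?X"
        by (rule sum_le_suminf) auto
      with 3 x have "r powr ((1 - \<theta>) * real j) * x j \<le> X"
        by (simp add: ennreal_le_iff)
      then show ?thesis
        using v unfolding vj by (simp add: field_simps)
    qed
    have leY: "x j \<le> Y * u ^ j" for j
      using le[of j] by (simp add: uj)
    \<comment> \<open>\<open>n\<close> is the first index past the crossing: \<open>leY\<close> is
      the better bound before it, \<open>leX\<close> from it on.\<close>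
    define z n where "z = X / Y" and "n = (LEAST n. z < r ^ n)"
    have z: "z > 0" using 3 by (simp add: z_def)
    obtain n0 where "z < r ^ n0"
      using real_arch_pow[OF r] by blast
    then have zn: "z < r ^ n"
      unfolding n_def by (rule LeastI)
    have zn': "r ^ m \<le> z" if "m < n" for m
      using not_less_Least[of m "\<lambda>n. z < r ^ n"] that by (simp add: n_def)
    \<comment> \<open>\<open>T\<close> is the common value of the two bounds at the crossing,
      \<open>r ^ j\<close> being replaced by \<open>z\<close>.\<close>
    define T where "T = X powr \<theta> * Y powr (1 - \<theta>)"
    have T1: "Y * z powr \<theta> = T" and T2: "X * z powr (- (1 - \<theta>)) = T"
      using 3 by (simp_all add: T_def z_def powr_divide powr_diff powr_minus powr_add field_simps)
    have low: "(\<Sum>j<n. x j) \<le> u / (u - 1) * T"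
    proof (cases n)
      case (Suc m)
      \<comment> \<open>Only \<open>m = n - 1\<close> is known to satisfy
        \<open>r ^ m \<le> z\<close>; passing to \<open>u ^ n\<close> costs the extra factor
        \<open>u\<close> in the numerator of \<open>K\<close>. For \<open>n = 0\<close> the sum is
        empty.\<close>
      have "u ^ m = (r ^ m) powr \<theta>"
        using r by (simp add: u_def powr_realpow[symmetric] powr_powr mult.commute)
      also have "\<dots> \<le> z powr \<theta>"
        using zn'[of m] r \<theta> Suc by (intro powr_mono2) auto
      finally have "u ^ n \<le> u * z powr \<theta>"
        using u Suc by simp
      have "(\<Sum>j<n. x j) \<le> (\<Sum>j<n. Y * u ^ j)"
        by (intro sum_mono leY)
      also have "\<dots> = Y * ((u ^ n - 1) / (u - 1))"
        using u by (simp add: sum_distrib_left[symmetric] geometric_sum)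
      also have "\<dots> \<le> Y * (u * z powr \<theta> / (u - 1))"
        using u 3 \<open>u ^ n \<le> u * z powr \<theta>\<close> by (intro mult_left_mono divide_right_mono) auto
      also have "\<dots> = u / (u - 1) * T"
        by (simp flip: T1)
      finally show ?thesis .
    qed (use u 3 in \<open>auto simp: T_def\<close>)
    have sm: "(\<lambda>j. X * v ^ (j + n)) sums (X * v ^ n * (1 / (1 - v)))"
      using sums_mult[OF geometric_sums[of v], of "X * v ^ n"] v
      by (simp add: power_add mult_ac)
    \<comment> \<open>Here \<open>z < r ^ n\<close> is used; the negative exponent reverses the
      inequality.\<close>
    have vn: "v ^ n \<le> z powr (- (1 - \<theta>))"
    proof -
      have "v ^ n = (r ^ n) powr (- (1 - \<theta>))"
        using r by (simp add: v_def powr_realpow[symmetric] powr_powr mult.commute)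
      also have "\<dots> \<le> z powr (- (1 - \<theta>))"
        using zn z \<theta> by (intro powr_mono2') auto
      finally show ?thesis .
    qed
    have high: "(\<Sum>j. ennreal (x (j + n))) \<le> ennreal (1 / (1 - v) * T)"
    proof -
      have "(\<Sum>j. ennreal (x (j + n))) \<le> (\<Sum>j. ennreal (X * v ^ (j + n)))"
        by (intro suminf_le ennreal_leI leX) auto
      also have "\<dots> = ennreal (X * v ^ n * (1 / (1 - v)))"
        using sm 3 v by (intro suminf_ennreal_eq) auto
      also have "\<dots> \<le> ennreal (X * z powr (- (1 - \<theta>)) * (1 / (1 - v)))"
        using vn v 3 by (intro ennreal_leI mult_right_mono mult_left_mono) auto
      finally show ?thesis
        unfolding T2 by (simp add: mult.commute)
    qed
    have "(\<Sum>j. ennreal (x j)) = (\<Sum>j. ennreal (x (j + n))) + (\<Sum>j<n. ennreal (x j))"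
      by (rule suminf_offset) auto
    also have "\<dots> \<le> ennreal (1 / (1 - v) * T) + ennreal (u / (u - 1) * T)"
      using high low x by (intro add_mono) (auto simp: ennreal_leI)
    also have "\<dots> = ennreal (K * T)"
    proof (subst ennreal_plus[symmetric])
      show "0 \<le> 1 / (1 - v) * T" "0 \<le> u / (u - 1) * T"
        using u v by (auto simp: T_def)
      show "ennreal (1 / (1 - v) * T + u / (u - 1) * T) = ennreal (K * T)"
        unfolding K_def u_def[symmetric] v_def[symmetric] distrib_right by (simp only: add.commute)
    qed
    also have "\<dots> = ennreal K * ennpowr ?X \<theta> * ennpowr (ennreal Y) (1 - \<theta>)"
      using 3 K by (simp add: T_def ennpowr_ennreal ennreal_mult mult.assoc)
    finally show ?thesis .
  qed
qed

theorem theorem3: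
  fixes p q \<theta> s s1 \<beta> :: real
  assumes "1 < p" and "p < q" and "\<theta> = p / q"
    and "s = \<theta> * s1 - (1 - \<theta>) * \<beta>" and "- \<beta> < s" and "s < s1"
  shows "\<exists>C::real. C > 0 \<and>
    (\<forall>f. f \<in> sobolev_space s1 p \<longrightarrow> f \<in> besov_space \<beta> \<longrightarrow>
      sobolev_norm s q f \<le>
        ennreal C * ennpowr (sobolev_norm s1 p f) \<theta> * ennpowr (besov_norm \<beta> f) (1 - \<theta>))"
proof -
  have \<theta>: "0 < \<theta>" "\<theta> < 1" and q: "0 < q" "\<theta> * q = p"
    using assms(1-3) by auto
  \<comment> \<open>\<open>s\<close> is the convex combination of \<open>s1\<close> and
    \<open>-\<beta>\<close> with weights \<open>\<theta>\<close> and \<open>1 - \<theta>\<close>, so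
    it splits the gap \<open>\<delta>\<close> into \<open>(1 - \<theta>) * \<delta>\<close> above
    and \<open>\<theta> * \<delta>\<close> below. The factor 2 in the exponent of \<open>r\<close>
    is there because the blocks enter squared.\<close>
  define \<delta> r where "\<delta> = s1 + \<beta>" and "r = 2 powr (2 * \<delta>)"
  have \<delta>: "\<delta> > 0" and s_\<beta>: "s + \<beta> = \<theta> * \<delta>" and s1_s: "s1 - s = (1 - \<theta>) * \<delta>"
    using assms(4-6) by (auto simp: \<delta>_def algebra_simps)
  have r: "r > 1"
    using \<delta> by (simp add: r_def)
  define K where "K = r powr \<theta> / (r powr \<theta> - 1) + 1 / (1 - r powr (- (1 - \<theta>)))"
  have K: "K > 0"
    unfolding K_def using r \<theta> by (intro add_pos_pos divide_pos_pos) (auto simp: powr_less_one)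
  \<comment> \<open>The square root undoes the squaring of the blocks.\<close>
  define C where "C = K powr (1 / 2)"
  have C: "C > 0" using K by (simp add: C_def)
  have "sobolev_norm s q f \<le>
      ennreal C * ennpowr (sobolev_norm s1 p f) \<theta> * ennpowr (besov_norm \<beta> f) (1 - \<theta>)"
    if f: "f \<in> besov_space \<beta>" for f
  proof -
    obtain B where B: "B \<ge> 0" "besov_norm \<beta> f = ennreal B"
      using f by (cases "besov_norm \<beta> f") (auto simp: besov_space_def)
    define D where "D j x = \<bar>dyadic_block j f x\<bar>" for j x
    define W where "W t x = (\<Sum>j. ennreal (2 powr (2 * real j * t) * (D j x)\<^sup>2))" for t x
    have sob: "sobolev_norm t p' f = ennpowr (\<integral>\<^sup>+x. ennpowr (W t x) (p' / 2) \<partial>haar) (1 / p')" for t p'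
      by (simp add: sobolev_norm_def Lp_norm_def W_def D_def ennpowr_ennpowr)
    have Linf_le: "ennreal (2 powr (- real j * \<beta>)) * Linf_norm (dyadic_block j f) \<le> ennreal B" for j
      unfolding B(2)[symmetric] besov_norm_def by (rule SUP_upper) simp
    have Linf: "Linf_norm (dyadic_block j f) < top" for j
      using Linf_le[of j] by (cases "Linf_norm (dyadic_block j f)") (auto simp: ennreal_mult_top top_unique)
    \<comment> \<open>Measurability is read off from the finite Besov norm: \<open>esssup\<close> of
      a non-measurable function is \<open>top\<close> by convention.\<close>
    have D_meas [measurable]: "(\<lambda>x. ennreal (D j x)) \<in> borel_measurable haar" for j
      unfolding D_def
    proof (rule ccontr)
      assume "(\<lambda>x. ennreal \<bar>dyadic_block j f x\<bar>) \<notin> borel_measurable haar"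
      then have "Linf_norm (dyadic_block j f) = top"
        unfolding Linf_norm_def by (rule esssup_non_measurable)
      with Linf[of j] show False by simp
    qed
    have W_meas [measurable]: "W t \<in> borel_measurable haar" for t
    proof -
      have "W t = (\<lambda>x. \<Sum>j. ennreal (2 powr (2 * real j * t)) * (ennreal (D j x))\<^sup>2)"
        unfolding W_def by (intro ext suminf_cong) (simp add: D_def ennreal_power flip: ennreal_mult)
      also have "\<dots> \<in> borel_measurable haar" by measurable
      finally show ?thesis .
    qed
    have "AE x in haar. D j x \<le> 2 powr (real j * \<beta>) * B" for j
      using esssup_AE[where f = "\<lambda>x. ennreal \<bar>dyadic_block j f x\<bar>" and M = haar]
    proof eventually_elim
      case (elim x)
      have "ennreal (2 powr (- real j * \<beta>) * D j x) \<le>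
          ennreal (2 powr (- real j * \<beta>)) * Linf_norm (dyadic_block j f)"
        using elim by (simp add: ennreal_mult D_def Linf_norm_def mult_left_mono)
      also note Linf_le
      finally have "2 powr (- real j * \<beta>) * D j x \<le> B"
        using B by (simp add: ennreal_le_iff)
      then show ?case
        by (simp add: powr_minus field_simps)
    qed
    \<comment> \<open>There are countably many \<open>j\<close>, so one null set serves them
      all.\<close>
    then have "AE x in haar. \<forall>j. D j x \<le> 2 powr (real j * \<beta>) * B"
      by (simp add: AE_all_countable)
    then have W_le: "AE x in haar. W s x \<le>
        ennreal K * ennpowr (W s1 x) \<theta> * ennpowr (ennreal (B\<^sup>2)) (1 - \<theta>)"
    proof eventually_elim
      case (elim x)
      define y where "y j = 2 powr (2 * real j * s) * (D j x)\<^sup>2" for j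
      have y_ge: "0 \<le> y j" for j
        by (simp add: y_def)
      have y_le: "y j \<le> B\<^sup>2 * r powr (\<theta> * real j)" for j
      proof -
        have "y j \<le> 2 powr (2 * real j * s) * (2 powr (real j * \<beta>) * B)\<^sup>2"
          unfolding y_def using elim by (intro mult_left_mono power_mono) (auto simp: D_def)
        also have "\<dots> = B\<^sup>2 * 2 powr (2 * real j * (s + \<beta>))"
          by (simp add: power_mult_distrib power2_eq_square powr_add[symmetric] algebra_simps)
        also have "\<dots> = B\<^sup>2 * r powr (\<theta> * real j)"
          by (simp add: s_\<beta> r_def powr_powr mult_ac)
        finally show ?thesis .
      qed
      \<comment> \<open>The weight raises the regularity from \<open>s\<close> to \<open>s1\<close>,
        so the weighted series of the lemma is \<open>W s1 x\<close>.\<close>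
      have y_s1: "r powr ((1 - \<theta>) * real j) * y j = 2 powr (2 * real j * s1) * (D j x)\<^sup>2" for j
      proof -
        have "r powr ((1 - \<theta>) * real j) = 2 powr (2 * real j * (s1 - s))"
          by (simp add: s1_s r_def powr_powr mult_ac)
        then show ?thesis
          by (simp add: y_def powr_add[symmetric] algebra_simps)
      qed
      show ?case
        using suminf_le_interpolation[OF r \<theta> y_ge zero_le_power2 y_le]
        unfolding y_s1 K_def[symmetric] W_def[symmetric] unfolding y_def W_def[symmetric] .
    qed
    \<comment> \<open>The factor independent of \<open>x\<close>, raised to the power
      \<open>q\<close> so that it leaves the integral and the final root \<open>1 / q\<close>
      restores it.\<close>
    define c where "c = ennpowr (ennreal C * ennpowr (ennreal B) (1 - \<theta>)) q"
    have "AE x in haar. ennpowr (W s x) (q / 2) \<le> c * ennpowr (W s1 x) (p / 2)"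
      using W_le
    proof eventually_elim
      case (elim x)
      have "ennpowr (W s x) (q / 2) \<le>
          ennpowr (ennreal K * ennpowr (W s1 x) \<theta> * ennpowr (ennreal (B\<^sup>2)) (1 - \<theta>)) (q / 2)"
        using q elim by (intro ennpowr_mono) auto
      also have "ennreal K = ennpowr (ennreal C) 2"
        using K by (simp add: C_def ennpowr_ennreal powr_powr)
      also have "ennreal (B\<^sup>2) = ennpowr (ennreal B) 2"
        using B by (simp add: ennpowr_ennreal)
      finally have "ennpowr (W s x) (q / 2) \<le> ennpowr (ennreal C) (2 * (q / 2)) *
          ennpowr (W s1 x) (\<theta> * (q / 2)) * ennpowr (ennreal B) (2 * ((1 - \<theta>) * (q / 2)))"
        by (simp only: ennpowr_mult ennpowr_ennpowr mult.assoc)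
      also have "2 * (q / 2) = q"
        by simp
      also have "\<theta> * (q / 2) = p / 2"
        using q by simp
      also have "2 * ((1 - \<theta>) * (q / 2)) = (1 - \<theta>) * q"
        by simp
      finally show ?case
        by (simp only: c_def ennpowr_mult ennpowr_ennpowr mult_ac)
    qed
    then have "(\<integral>\<^sup>+x. ennpowr (W s x) (q / 2) \<partial>haar) \<le> (\<integral>\<^sup>+x. c * ennpowr (W s1 x) (p / 2) \<partial>haar)"
      by (rule nn_integral_mono_AE)
    also have "\<dots> = c * (\<integral>\<^sup>+x. ennpowr (W s1 x) (p / 2) \<partial>haar)"
      by (rule nn_integral_cmult) measurable
    finally have "sobolev_norm s q f \<le> ennpowr (c * (\<integral>\<^sup>+x. ennpowr (W s1 x) (p / 2) \<partial>haar)) (1 / q)"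
      unfolding sob using q by (intro ennpowr_mono) auto
    \<comment> \<open>As \<open>1 / q = (1 / p) * \<theta>\<close>, the root of order
      \<open>q\<close> of the integral is the \<open>\<theta>\<close>-th power of the Sobolev
      norm.\<close>
    also have "\<dots> = ennreal C * ennpowr (sobolev_norm s1 p f) \<theta> * ennpowr (besov_norm \<beta> f) (1 - \<theta>)"
      using q assms(1-3) unfolding sob B(2)
      by (simp add: c_def ennpowr_mult ennpowr_ennpowr mult_ac)
    finally show ?thesis .
  qed
  with C show ?thesis by blast
qed

end
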